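(* Let $K$ be a field and let $L=L(\mathsf R,K)$ be the Chevalley algebra over $K$ of a root system $\mathsf R$. For each $m$, let $P_m(X,Y)$ be the Engel polynomial of degree $m$ and let $P_m\colon L^2\to L$ be the corresponding map. Then for all sufficiently large $m$ the image of $P_m$ contains no nonzero element of the centre $Z(L)$ of $L$.
   Context: Chevalley algebra: let $\mathsf R$ be a reduced root system with a system of simple roots $\Pi$, and let $L(\mathsf R,\mathbb C)$ be the complex semisimple Lie algebra with root system $\mathsf R$. It has a Chevalley basis $\{h_\alpha\}_{\alpha\in\Pi}\cup\{e_\beta\}_{\beta\in\mathsf R}$ such that: $[e_\alpha,e_{-\alpha}]=h_\alpha$ for $\alpha\in\Pi$; $h_\beta:=[e_\beta,e_{-\beta}]\in\sum_{\alpha\in\Pi}\mathbb Z h_\alpha$ for $\beta\in\mathsf R$; $[h_\beta,h_\gamma]=0$; $[h_\beta,e_\gamma]=q_{\beta,\gamma}e_\gamma$ with $q_{\beta,\gamma}\in\{0,\pm1,\pm2,\pm3\}$; $[e_\beta,e_\gamma]=0$ if $\beta+\gamma\notin\mathsf R$ and $\gamma\neq-\beta$; $[e_\beta,e_\gamma]=p_{\beta,\gamma}e_{\beta+\gamma}$ with $p_{\beta,\gamma}\in\{\pm1,\pm2,\pm3\}$ if $\beta+\gamma\in\mathsf R$. The Chevalley algebra $L(\mathsf R,K)$ is the Lie algebra over $K$ with the same basis and the same structure constants (read in the prime field of $K$), i.e. the $\mathbb Z$-span of the Chevalley basis tensored with $K$. Engel polynomials: in the free Lie $K$-algebra on $X,Y$,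 put $E_1(X,Y)=[X,Y]$ and $E_n(X,Y)=[E_{n-1}(X,Y),Y]$ for $n\ge2$ (so $E_n=[[\dots[X,Y],Y],\dots,Y]$ with $n$ brackets). The Engel polynomial of degree $m$ ($m\ge2$) is $P_m=E_{m-1}$. It induces a map $L^2\to L$ by substitution. *)

theory Defs
  imports "HOL-Analysis.Analysis"
begin

section \<open>Root systems\<close>

text \<open>
  The ambient Euclidean space of a root system is the real span of the roots, so no condition
  relating \<open>R\<close> to the whole type is imposed, and the empty root system is allowed.
\<close>

definition cartan_number :: "'v::real_inner \<Rightarrow> 'v \<Rightarrow> real" where
  "cartan_number \<gamma> \<beta> = 2 * (\<gamma> \<bullet> \<beta>) / (\<beta> \<bullet> \<beta>)"

definition reduced_root_system :: "'v::real_inner set \<Rightarrow> bool" where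
  "reduced_root_system R \<longleftrightarrow>
     finite R \<and> 0 \<notin> R \<and>
     (\<forall>\<beta>\<in>R. \<forall>\<gamma>\<in>R. \<gamma> - cartan_number \<gamma> \<beta> *\<^sub>R \<beta> \<in> R) \<and>
     (\<forall>\<beta>\<in>R. \<forall>\<gamma>\<in>R. cartan_number \<gamma> \<beta> \<in> \<int>) \<and>
     (\<forall>\<beta>\<in>R. \<forall>c. c *\<^sub>R \<beta> \<in> R \<longrightarrow> c = 1 \<or> c = -1)"

definition simple_roots :: "'v::real_inner set \<Rightarrow> 'v set \<Rightarrow> bool" where
  "simple_roots R \<Delta> \<longleftrightarrow>
     \<Delta> \<subseteq> R \<and> independent \<Delta> \<and>
     (\<forall>\<beta>\<in>R. \<exists>k :: 'v \<Rightarrow> int. \<beta> = (\<Sum>\<alpha>\<in>\<Delta>. of_int (k \<alpha>) *\<^sub>R \<alpha>) \<and>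
        ((\<forall>\<alpha>\<in>\<Delta>. 0 \<le> k \<alpha>) \<or> (\<forall>\<alpha>\<in>\<Delta>. k \<alpha> \<le> 0)))"


section \<open>Lie algebras\<close>

locale lie_algebra = vector_space scale
  for scale :: "'k::field \<Rightarrow> 'l::ab_group_add \<Rightarrow> 'l" +
  fixes bracket :: "'l \<Rightarrow> 'l \<Rightarrow> 'l"
  assumes bracket_add_left: "bracket (x + y) z = bracket x z + bracket y z"
    and bracket_add_right: "bracket x (y + z) = bracket x y + bracket x z"
    and bracket_scale_left: "bracket (scale a x) y = scale a (bracket x y)"
    and bracket_scale_right: "bracket x (scale a y) = scale a (bracket x y)"
    and bracket_self: "bracket x x = 0"
    and jacobi: "bracket x (bracket y z) + bracket y (bracket z x) + bracket z (bracket x y) = 0"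
begin

definition centre :: "'l set" where
  "centre = {z. \<forall>x. bracket z x = 0}"

definition bracket_span :: "'l set \<Rightarrow> 'l set \<Rightarrow> 'l set" where
  "bracket_span A B = span {bracket a b |a b. a \<in> A \<and> b \<in> B}"

definition lie_ideal :: "'l set \<Rightarrow> bool" where
  "lie_ideal J \<longleftrightarrow> subspace J \<and> (\<forall>x. \<forall>y\<in>J. bracket x y \<in> J)"

definition lie_subalgebra :: "'l set \<Rightarrow> bool" where
  "lie_subalgebra S \<longleftrightarrow> subspace S \<and> (\<forall>x\<in>S. \<forall>y\<in>S. bracket x y \<in> S)"

definition lie_solvable :: "'l set \<Rightarrow> bool" where
  "lie_solvable S \<longleftrightarrow> (\<exists>n. ((\<lambda>T. bracket_span T T) ^^ n) S = {0})"

definition lie_nilpotent :: "'l set \<Rightarrow> bool" where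
  "lie_nilpotent S \<longleftrightarrow> (\<exists>n. ((\<lambda>T. bracket_span S T) ^^ n) S = {0})"

definition semisimple :: bool where
  "semisimple \<longleftrightarrow>
     (\<exists>B. finite B \<and> span B = UNIV) \<and>
     (\<forall>J. lie_ideal J \<and> lie_solvable J \<longrightarrow> J = {0})"

definition cartan_subalgebra :: "'l set \<Rightarrow> bool" where
  "cartan_subalgebra H \<longleftrightarrow>
     lie_subalgebra H \<and> lie_nilpotent H \<and> {x. \<forall>h\<in>H. bracket x h \<in> H} = H"

definition root_space :: "'l set \<Rightarrow> ('l \<Rightarrow> 'k) \<Rightarrow> 'l set" where
  "root_space H \<phi> = {x. \<forall>h\<in>H. bracket h x = scale (\<phi> h) x}"

text \<open>
  Linear functionals on \<open>H\<close> are represented by functions on the whole algebra of which only the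
  values on \<open>H\<close> matter.  Linearity of \<open>\<phi>\<close> on \<open>H\<close> follows from the second conjunct.
\<close>

definition is_root :: "'l set \<Rightarrow> ('l \<Rightarrow> 'k) \<Rightarrow> bool" where
  "is_root H \<phi> \<longleftrightarrow> (\<exists>h\<in>H. \<phi> h \<noteq> 0) \<and> root_space H \<phi> \<noteq> {0}"

definition is_basis :: "'i set \<Rightarrow> ('i \<Rightarrow> 'l) \<Rightarrow> bool" where
  "is_basis I b \<longleftrightarrow> inj_on b I \<and> independent (b ` I) \<and> span (b ` I) = UNIV"

text \<open>
  The integer coefficient of \<open>b k\<close> in the bracket of \<open>b i\<close> and \<open>b j\<close>; meaningful only if that
  coefficient is the image of a unique integer, as is the case for a Chevalley basis over the
  complex numbers (\<open>bracket_chevalley_family\<close> below).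
\<close>

definition int_structure_constant :: "'i set \<Rightarrow> ('i \<Rightarrow> 'l) \<Rightarrow> 'i \<Rightarrow> 'i \<Rightarrow> 'i \<Rightarrow> int" where
  "int_structure_constant I b i j k =
     (THE n. representation (b ` I) (bracket (b i) (b j)) (b k) = of_int n)"

lemma int_structure_constant_eq:
  assumes "finite I" "is_basis I b" "inj (of_int :: int \<Rightarrow> 'k)" "k \<in> I"
    and eq: "bracket (b i) (b j) = (\<Sum>l\<in>I. scale (of_int (n l)) (b l))"
  shows "int_structure_constant I b i j k = n k"
proof -
  have ind: "independent (b ` I)" and inj: "inj_on b I" and sp: "span (b ` I) = UNIV"
    using assms(2) by (auto simp: is_basis_def)
  have "representation (b ` I) (bracket (b i) (b j)) (b k)
      = (\<Sum>l\<in>I. of_int (n l) * (if b k = b l then 1 else 0))"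
    unfolding eq using ind sp
    by (simp add: representation_sum representation_scale representation_basis)
  also have "\<dots> = (\<Sum>l\<in>I. if l = k then of_int (n l) else 0)"
    using inj assms(4) by (intro sum.cong) (auto dest: inj_onD)
  also have "\<dots> = of_int (n k)"
    using assms(1,4) by simp
  finally show ?thesis
    unfolding int_structure_constant_def using assms(3) by (auto dest: injD)
qed

lemma bracket_zero_left [simp]: "bracket 0 x = 0"
  using bracket_add_left[of 0 0 x] by simp

lemma bracket_zero_right [simp]: "bracket x 0 = 0"
  using bracket_add_right[of x 0 0] by simp

lemma bracket_anticomm: "bracket x y = - bracket y x"
proof -
  have "bracket (x + y) (x + y) = bracket x y + bracket y x"
    unfolding bracket_add_left bracket_add_right by (simp add: bracket_self)
  then show ?thesis by (simp add: bracket_self eq_neg_iff_add_eq_0)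
qed

end


section \<open>Chevalley bases and Chevalley algebras\<close>

locale complex_lie_algebra = lie_algebra scale bracket
  for scale :: "complex \<Rightarrow> 'g::ab_group_add \<Rightarrow> 'g" and bracket :: "'g \<Rightarrow> 'g \<Rightarrow> 'g"
begin

text \<open>
  The semisimple algebra has root system \<open>R\<close> with respect to the Cartan subalgebra \<open>H\<close>: the map
  \<open>\<iota>\<close> is a real linear isomorphism from the span of \<open>R\<close> onto the real span of the roots of
  \<open>H\<close> and sends \<open>R\<close> onto the set of these roots (an isomorphism of root systems).
\<close>

definition has_root_system :: "'v::real_inner set \<Rightarrow> 'g set \<Rightarrow> ('v \<Rightarrow> 'g \<Rightarrow> complex) \<Rightarrow> bool" where
  "has_root_system R H \<iota> \<longleftrightarrow>
     semisimple \<and> cartan_subalgebra H \<and>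
     (\<forall>u\<in>real_vector.span R. \<forall>v\<in>real_vector.span R. \<forall>h\<in>H. \<iota> (u + v) h = \<iota> u h + \<iota> v h) \<and>
     (\<forall>c. \<forall>v\<in>real_vector.span R. \<forall>h\<in>H. \<iota> (c *\<^sub>R v) h = of_real c * \<iota> v h) \<and>
     (\<forall>v\<in>real_vector.span R. (\<forall>h\<in>H. \<iota> v h = 0) \<longrightarrow> v = 0) \<and>
     (\<forall>\<beta>\<in>R. is_root H (\<iota> \<beta>)) \<and>
     (\<forall>\<phi>. is_root H \<phi> \<longrightarrow> (\<exists>\<beta>\<in>R. \<forall>h\<in>H. \<phi> h = \<iota> \<beta> h))"

definition chevalley_h :: "('v::real_inner \<Rightarrow> 'g) \<Rightarrow> 'v \<Rightarrow> 'g" where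
  "chevalley_h e \<beta> = bracket (e \<beta>) (e (- \<beta>))"

text \<open>
  The basis consisting of the \<open>h\<^sub>\<alpha>\<close> (\<open>\<alpha>\<close> simple) and the \<open>e\<^sub>\<beta>\<close> (\<open>\<beta>\<close> a root) is indexed by
  \<open>\<Delta> <+> R\<close>.
\<close>

definition chevalley_family :: "('v::real_inner \<Rightarrow> 'g) \<Rightarrow> 'v + 'v \<Rightarrow> 'g" where
  "chevalley_family e = case_sum (chevalley_h e) e"

text \<open>
  The bounds on the structure constants alone do not determine the integral form (in rank one,
  for instance, they would permit rescaling \<open>e\<^sub>\<beta>\<close> so that \<open>[h\<^sub>\<beta>, e\<^sub>\<beta>] = e\<^sub>\<beta>\<close>).  As usual for
  Chevalley bases, the constants are therefore normalised: \<open>q\<close> is the Cartan integer and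
  \<open>\<bar>p\<bar> = r + 1\<close>, where \<open>r\<close> is the greatest number such that \<open>\<gamma> - r \<beta>\<close> is a root.
\<close>

definition chevalley_basis ::
  "'v::real_inner set \<Rightarrow> 'v set \<Rightarrow> 'g set \<Rightarrow> ('v \<Rightarrow> 'g \<Rightarrow> complex) \<Rightarrow> ('v \<Rightarrow> 'g) \<Rightarrow> bool" where
  "chevalley_basis R \<Delta> H \<iota> e \<longleftrightarrow>
     is_basis (\<Delta> <+> R) (chevalley_family e) \<and>
     (\<forall>\<alpha>\<in>\<Delta>. chevalley_h e \<alpha> \<in> H) \<and>
     (\<forall>\<beta>\<in>R. e \<beta> \<in> root_space H (\<iota> \<beta>)) \<and>
     (\<forall>\<beta>\<in>R. \<exists>n :: 'v \<Rightarrow> int.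
        chevalley_h e \<beta> = (\<Sum>\<alpha>\<in>\<Delta>. scale (of_int (n \<alpha>)) (chevalley_h e \<alpha>))) \<and>
     (\<forall>\<beta>\<in>R. \<forall>\<gamma>\<in>R. bracket (chevalley_h e \<beta>) (chevalley_h e \<gamma>) = 0) \<and>
     (\<forall>\<beta>\<in>R. \<forall>\<gamma>\<in>R. \<exists>q :: int. q \<in> {0, 1, -1, 2, -2, 3, -3} \<and>
        of_int q = cartan_number \<gamma> \<beta> \<and>
        bracket (chevalley_h e \<beta>) (e \<gamma>) = scale (of_int q) (e \<gamma>)) \<and>
     (\<forall>\<beta>\<in>R. \<forall>\<gamma>\<in>R. \<beta> + \<gamma> \<notin> R \<and> \<gamma> \<noteq> - \<beta> \<longrightarrow> bracket (e \<beta>) (e \<gamma>) = 0) \<and>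
     (\<forall>\<beta>\<in>R. \<forall>\<gamma>\<in>R. \<beta> + \<gamma> \<in> R \<longrightarrow> (\<exists>p :: int. p \<in> {1, -1, 2, -2, 3, -3} \<and>
        \<bar>p\<bar> = 1 + int (GREATEST r. \<gamma> - of_nat r *\<^sub>R \<beta> \<in> R) \<and>
        bracket (e \<beta>) (e \<gamma>) = scale (of_int p) (e (\<beta> + \<gamma>))))"

abbreviation chevalley_constant ::
  "'v::real_inner set \<Rightarrow> 'v set \<Rightarrow> ('v \<Rightarrow> 'g) \<Rightarrow> 'v + 'v \<Rightarrow> 'v + 'v \<Rightarrow> 'v + 'v \<Rightarrow> int" where
  "chevalley_constant R \<Delta> e \<equiv> int_structure_constant (\<Delta> <+> R) (chevalley_family e)"

lemma bracket_chevalley_family: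
  fixes R \<Delta> :: "'v::real_inner set"
  assumes "finite R" "simple_roots R \<Delta>" "chevalley_basis R \<Delta> H \<iota> e"
    and "i \<in> \<Delta> <+> R" "j \<in> \<Delta> <+> R"
  shows "bracket (chevalley_family e i) (chevalley_family e j) =
    (\<Sum>k\<in>\<Delta> <+> R. scale (of_int (chevalley_constant R \<Delta> e i j k)) (chevalley_family e k))"
proof -
  let ?I = "\<Delta> <+> R" and ?b = "chevalley_family e"
  define Z where "Z = {\<Sum>k\<in>?I. scale (of_int (n k)) (?b k) |n :: 'v + 'v \<Rightarrow> int. True}"
  have \<Delta>: "\<Delta> \<subseteq> R" and fin\<Delta>: "finite \<Delta>"
    using assms(1,2) by (auto simp: simple_roots_def intro: finite_subset)
  have fin: "finite ?I"
    using fin\<Delta> assms(1) by simp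
  note ch = assms(3)[unfolded chevalley_basis_def]
  have basis: "is_basis ?I ?b"
    using ch by blast
  have Z0: "0 \<in> Z"
    unfolding Z_def by (auto intro!: exI[of _ "\<lambda>_. 0"])
  have Ze: "scale (of_int c) (e \<beta>) \<in> Z" if "\<beta> \<in> R" for c \<beta>
    unfolding Z_def mem_Collect_eq
  proof (intro exI conjI)
    have "(\<Sum>k\<in>?I. scale (of_int (if k = Inr \<beta> then c else 0)) (?b k)) =
        (\<Sum>k\<in>?I. if k = Inr \<beta> then scale (of_int c) (e \<beta>) else 0)"
      by (intro sum.cong) (auto simp: chevalley_family_def)
    then show "scale (of_int c) (e \<beta>) =
        (\<Sum>k\<in>?I. scale (of_int (if k = Inr \<beta> then c else 0)) (?b k))"
      using fin that by (simp add: InrI)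
  qed simp
  have Zneg: "- z \<in> Z" if z: "z \<in> Z" for z
  proof -
    obtain n :: "'v + 'v \<Rightarrow> int" where "z = (\<Sum>k\<in>?I. scale (of_int (n k)) (?b k))"
      using z by (auto simp: Z_def)
    then have "- z = (\<Sum>k\<in>?I. scale (of_int (- n k)) (?b k))"
      by (simp add: sum_negf)
    then show ?thesis unfolding Z_def by (blast intro: exI[of _ "\<lambda>k. - n k"])
  qed
  have Zh: "chevalley_h e \<beta> \<in> Z" if "\<beta> \<in> R" for \<beta>
  proof -
    obtain n :: "'v \<Rightarrow> int" where
      n: "chevalley_h e \<beta> = (\<Sum>\<alpha>\<in>\<Delta>. scale (of_int (n \<alpha>)) (chevalley_h e \<alpha>))"
      using ch \<open>\<beta> \<in> R\<close> by blast
    have "(\<Sum>k\<in>?I. scale (of_int (case_sum n (\<lambda>_. 0) k)) (?b k)) = chevalley_h e \<beta>"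
      unfolding n using fin\<Delta> assms(1) by (simp add: sum.Plus chevalley_family_def)
    then show ?thesis unfolding Z_def mem_Collect_eq
      by (intro exI[of _ "case_sum n (\<lambda>_. 0)"]) simp
  qed
  have he: "bracket (chevalley_h e \<alpha>) (e \<gamma>) \<in> Z" if "\<alpha> \<in> R" "\<gamma> \<in> R" for \<alpha> \<gamma>
  proof -
    obtain q :: int where "bracket (chevalley_h e \<alpha>) (e \<gamma>) = scale (of_int q) (e \<gamma>)"
      using ch \<open>\<alpha> \<in> R\<close> \<open>\<gamma> \<in> R\<close> by blast
    then show ?thesis using Ze[OF that(2)] by simp
  qed
  have hh: "bracket (chevalley_h e \<alpha>) (chevalley_h e \<gamma>) \<in> Z" if "\<alpha> \<in> R" "\<gamma> \<in> R" for \<alpha> \<gamma>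
    using ch that Z0 by simp
  have ee: "bracket (e \<beta>) (e \<gamma>) \<in> Z" if "\<beta> \<in> R" "\<gamma> \<in> R" for \<beta> \<gamma>
  proof (cases "\<beta> + \<gamma> \<in> R")
    case True
    then obtain p :: int where "bracket (e \<beta>) (e \<gamma>) = scale (of_int p) (e (\<beta> + \<gamma>))"
      using ch \<open>\<beta> \<in> R\<close> \<open>\<gamma> \<in> R\<close> by blast
    then show ?thesis using Ze[OF True] by simp
  next
    case False
    show ?thesis
    proof (cases "\<gamma> = - \<beta>")
      case True
      then show ?thesis using Zh[OF that(1)] by (simp add: chevalley_h_def)
    next
      case False
      with \<open>\<beta> + \<gamma> \<notin> R\<close> have "bracket (e \<beta>) (e \<gamma>) = 0" using ch that by blast
      then show ?thesis using Z0 by simp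
    qed
  qed
  have eh: "bracket (e \<gamma>) (chevalley_h e \<alpha>) \<in> Z" if "\<alpha> \<in> R" "\<gamma> \<in> R" for \<alpha> \<gamma>
    using Zneg[OF he[OF that]] bracket_anticomm by metis
  have "bracket (?b i) (?b j) \<in> Z"
    using assms(4,5)
    by (auto simp: chevalley_family_def intro!: hh he eh ee dest: subsetD[OF \<Delta>])
  then obtain n :: "'v + 'v \<Rightarrow> int"
    where n: "bracket (?b i) (?b j) = (\<Sum>k\<in>?I. scale (of_int (n k)) (?b k))"
    by (auto simp: Z_def)
  have "inj (of_int :: int \<Rightarrow> complex)"
    by (rule injI) simp
  then have "chevalley_constant R \<Delta> e i j k = n k" if "k \<in> ?I" for k
    using int_structure_constant_eq[OF fin basis _ that n] by blast
  then show ?thesis unfolding n by simp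
qed

end

text \<open>
  \<open>L(R, K)\<close>: the Lie algebra \<open>(sK, brK)\<close> over \<open>K\<close> has a basis \<open>b\<close>, indexed by the same set as the
  Chevalley basis of the complex algebra \<open>(sC, brC)\<close>, with the same integral structure constants
  read in \<open>K\<close>.
\<close>

locale chevalley_algebra =
  C: complex_lie_algebra sC brC + L: lie_algebra sK brK
  for sC :: "complex \<Rightarrow> 'g::ab_group_add \<Rightarrow> 'g" and brC :: "'g \<Rightarrow> 'g \<Rightarrow> 'g"
    and sK :: "'k::field \<Rightarrow> 'l::ab_group_add \<Rightarrow> 'l" and brK :: "'l \<Rightarrow> 'l \<Rightarrow> 'l" +
  fixes R \<Delta> :: "'v::real_inner set"
    and H :: "'g set" and \<iota> :: "'v \<Rightarrow> 'g \<Rightarrow> complex" and e :: "'v \<Rightarrow> 'g"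
    and b :: "'v + 'v \<Rightarrow> 'l"
  assumes root_system: "reduced_root_system R"
    and simple: "simple_roots R \<Delta>"
    and complex_root_system: "C.has_root_system R H \<iota>"
    and chevalley: "C.chevalley_basis R \<Delta> H \<iota> e"
    and basis: "L.is_basis (\<Delta> <+> R) b"
    and structure_constants: "\<And>i j. i \<in> \<Delta> <+> R \<Longrightarrow> j \<in> \<Delta> <+> R \<Longrightarrow>
      brK (b i) (b j) = (\<Sum>k\<in>\<Delta> <+> R. sK (of_int (C.chevalley_constant R \<Delta> e i j k)) (b k))"


section \<open>Free Lie algebras and Engel polynomials\<close>

datatype ('a, 'k) lie_term =
    Gen 'a
  | Zero
  | Add "('a, 'k) lie_term" "('a, 'k) lie_term"
  | Scale 'k "('a, 'k) lie_term"
  | Bracket "('a, 'k) lie_term" "('a, 'k) lie_term"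

text \<open>The least congruence on terms modulo which the axioms of a Lie algebra hold.\<close>

inductive lie_eq :: "('a, 'k::field) lie_term \<Rightarrow> ('a, 'k) lie_term \<Rightarrow> bool" where
  refl: "lie_eq t t"
| sym: "lie_eq s t \<Longrightarrow> lie_eq t s"
| trans: "lie_eq s t \<Longrightarrow> lie_eq t u \<Longrightarrow> lie_eq s u"
| cong_add: "lie_eq s s' \<Longrightarrow> lie_eq t t' \<Longrightarrow> lie_eq (Add s t) (Add s' t')"
| cong_scale: "lie_eq t t' \<Longrightarrow> lie_eq (Scale a t) (Scale a t')"
| cong_bracket: "lie_eq s s' \<Longrightarrow> lie_eq t t' \<Longrightarrow> lie_eq (Bracket s t) (Bracket s' t')"
| add_assoc: "lie_eq (Add (Add s t) u) (Add s (Add t u))"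
| add_comm: "lie_eq (Add s t) (Add t s)"
| add_zero: "lie_eq (Add Zero t) t"
| add_inv: "lie_eq (Add (Scale (-1) t) t) Zero"
| scale_add_right: "lie_eq (Scale a (Add s t)) (Add (Scale a s) (Scale a t))"
| scale_add_left: "lie_eq (Scale (a + b) t) (Add (Scale a t) (Scale b t))"
| scale_scale: "lie_eq (Scale a (Scale b t)) (Scale (a * b) t)"
| scale_one: "lie_eq (Scale 1 t) t"
| bracket_add_left: "lie_eq (Bracket (Add s t) u) (Add (Bracket s u) (Bracket t u))"
| bracket_add_right: "lie_eq (Bracket s (Add t u)) (Add (Bracket s t) (Bracket s u))"
| bracket_scale_left: "lie_eq (Bracket (Scale a s) t) (Scale a (Bracket s t))"
| bracket_scale_right: "lie_eq (Bracket s (Scale a t)) (Scale a (Bracket s t))"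
| bracket_self: "lie_eq (Bracket t t) Zero"
| jacobi: "lie_eq (Add (Add (Bracket s (Bracket t u)) (Bracket t (Bracket u s)))
    (Bracket u (Bracket s t))) Zero"

lemma lie_eq_equivp: "equivp lie_eq"
  by (rule equivpI) (auto intro!: reflpI sympI transpI intro: lie_eq.refl lie_eq.sym lie_eq.trans)

quotient_type (overloaded) ('a, 'k) free_lie = "('a, 'k::field) lie_term" / lie_eq
  by (rule lie_eq_equivp)

instantiation free_lie :: (type, field) ab_group_add
begin

lift_definition zero_free_lie :: "('a, 'b) free_lie" is Zero .
lift_definition plus_free_lie :: "('a, 'b) free_lie \<Rightarrow> ('a, 'b) free_lie \<Rightarrow> ('a, 'b) free_lie"
  is Add by (rule lie_eq.cong_add)
lift_definition uminus_free_lie :: "('a, 'b) free_lie \<Rightarrow> ('a, 'b) free_lie"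
  is "Scale (-1)" by (rule lie_eq.cong_scale)
definition minus_free_lie :: "('a, 'b) free_lie \<Rightarrow> ('a, 'b) free_lie \<Rightarrow> ('a, 'b) free_lie" where
  "minus_free_lie x y = x + - y"

instance
  by standard
    (simp add: minus_free_lie_def |
     (transfer, blast intro: lie_eq.add_assoc lie_eq.add_comm lie_eq.add_zero lie_eq.add_inv))+

end

lift_definition free_gen :: "'a \<Rightarrow> ('a, 'k::field) free_lie" is Gen .
lift_definition free_scale :: "'k::field \<Rightarrow> ('a, 'k) free_lie \<Rightarrow> ('a, 'k) free_lie"
  is Scale by (rule lie_eq.cong_scale)
lift_definition free_bracket ::
  "('a, 'k::field) free_lie \<Rightarrow> ('a, 'k) free_lie \<Rightarrow> ('a, 'k) free_lie"
  is Bracket by (rule lie_eq.cong_bracket)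

interpretation free_lie: lie_algebra free_scale free_bracket
  by unfold_locales
    (transfer, blast intro: lie_eq.intros)+

context lie_algebra
begin

primrec eval_term :: "('a \<Rightarrow> 'l) \<Rightarrow> ('a, 'k) lie_term \<Rightarrow> 'l" where
  "eval_term f (Gen a) = f a"
| "eval_term f Zero = 0"
| "eval_term f (Add s t) = eval_term f s + eval_term f t"
| "eval_term f (Scale c t) = scale c (eval_term f t)"
| "eval_term f (Bracket s t) = bracket (eval_term f s) (eval_term f t)"

text \<open>
  Substitution of \<open>f a\<close> for each generator \<open>a\<close>, computed on a representing term; independence of
  the term is shown below.
\<close>

definition subst_lie :: "('a \<Rightarrow> 'l) \<Rightarrow> ('a, 'k) free_lie \<Rightarrow> 'l" where
  "subst_lie f P = eval_term f (rep_free_lie P)"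

lemma eval_term_lie_eq:
  assumes "lie_eq s t"
  shows "eval_term f s = eval_term f t"
  using assms
  by (induction rule: lie_eq.induct)
    (simp_all add: bracket_add_left bracket_add_right bracket_scale_left bracket_scale_right
      bracket_self jacobi[unfolded add.assoc] scale_right_distrib scale_left_distrib add_ac)

lemma subst_lie_abs: "subst_lie f (abs_free_lie t) = eval_term f t"
  unfolding subst_lie_def
  by (rule eval_term_lie_eq) (rule Quotient3_free_lie[THEN rep_abs_rsp_left, OF lie_eq.refl])

lemma subst_lie_simps:
  "subst_lie f (free_gen a) = f a"
  "subst_lie f 0 = 0"
  "subst_lie f (P + Q) = subst_lie f P + subst_lie f Q"
  "subst_lie f (free_scale c P) = scale c (subst_lie f P)"
  "subst_lie f (free_bracket P Q) = bracket (subst_lie f P) (subst_lie f Q)"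
proof -
  obtain s where P: "P = abs_free_lie s" by (induct P rule: free_lie.abs_induct) blast
  obtain t where Q: "Q = abs_free_lie t" by (induct Q rule: free_lie.abs_induct) blast
  show "subst_lie f (free_gen a) = f a" by (simp add: free_gen_def subst_lie_abs)
  show "subst_lie f 0 = 0" by (simp add: zero_free_lie_def subst_lie_abs)
  show "subst_lie f (P + Q) = subst_lie f P + subst_lie f Q"
    by (simp add: P Q plus_free_lie.abs_eq subst_lie_abs)
  show "subst_lie f (free_scale c P) = scale c (subst_lie f P)"
    by (simp add: P free_scale.abs_eq subst_lie_abs)
  show "subst_lie f (free_bracket P Q) = bracket (subst_lie f P) (subst_lie f Q)"
    by (simp add: P Q free_bracket.abs_eq subst_lie_abs)
qed

end

datatype engel_var = X | Y

text \<open>Thus \<open>E\<^sub>1 = [X, Y]\<close>; the starting value \<open>E\<^sub>0 = X\<close> is only an anchor for the recursion.\<close>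

primrec engel_E :: "nat \<Rightarrow> (engel_var, 'k::field) free_lie" where
  "engel_E 0 = free_gen X"
| "engel_E (Suc n) = free_bracket (engel_E n) (free_gen Y)"

definition engel_polynomial :: "nat \<Rightarrow> (engel_var, 'k::field) free_lie" where
  "engel_polynomial m = engel_E (m - 1)"

definition (in lie_algebra) polynomial_map :: "(engel_var, 'k) free_lie \<Rightarrow> 'l \<times> 'l \<Rightarrow> 'l" where
  "polynomial_map P = (\<lambda>(x, y). subst_lie (case_engel_var x y) P)"

end

theory Submission
  imports Defs
begin

text \<open>
  Up to sign, the Engel polynomial of degree \<open>m\<close> sends \<open>(x, y)\<close> to \<open>(ad y)\<^bsup>m - 1\<^esup> x\<close>. If this
  value is central, it is killed by \<open>ad y\<close>, so \<open>x\<close> lies in the kernel of \<open>(ad y)\<^bsup>m\<^esup>\<close>. The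
  kernels of the powers of an endomorphism are constant from the dimension on; hence the value
  is \<open>0\<close> as soon as \<open>m > dim L\<close>.
\<close>

context vector_space
begin

lemma linear_funpow:
  assumes "Vector_Spaces.linear scale scale f"
  shows "Vector_Spaces.linear scale scale (f ^^ n)"
proof (induction n)
  case 0
  show ?case unfolding funpow.simps(1) by (rule linear_id)
next
  case (Suc n)
  then show ?case
    unfolding funpow.simps(2) by (rule Vector_Spaces.linear_compose) (rule assms)
qed

text \<open>Induction on the length of the chain, prepending \<open>x\<close> to the chain of
  \<open>f x\<close>. The power \<open>f ^^ Suc k\<close> kills every vector of the chain of
  \<open>f x\<close>, hence its span, but does not kill \<open>x\<close>.\<close>

lemma funpow_kernel_chain_independent:
  assumes f: "Vector_Spaces.linear scale scale f"
    and "(f ^^ k) x \<noteq> 0" "(f ^^ Suc k) x = 0"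
  shows "independent ((\<lambda>i. (f ^^ i) x) ` {..k})
    \<and> card ((\<lambda>i. (f ^^ i) x) ` {..k}) = Suc k"
  using assms(2,3)
proof (induction k arbitrary: x)
  case 0
  then show ?case by simp
next
  case (Suc k)
  let ?S = "(\<lambda>i. (f ^^ i) (f x)) ` {..k}"
  have S: "independent ?S" "card ?S = Suc k"
    using Suc.IH[of "f x"] Suc.prems
    by (simp_all only: funpow_Suc_right[of "Suc k"] funpow_Suc_right[of k] o_apply not_False_eq_True)
  interpret F: Vector_Spaces.linear scale scale "f ^^ Suc k"
    by (rule linear_funpow[OF f])
  interpret f: Vector_Spaces.linear scale scale f by (rule f)
  have zero: "(f ^^ n) 0 = 0" for n
    by (induction n) (simp_all add: f.zero)
  have "(f ^^ Suc k) ((f ^^ i) (f x)) = 0" for i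
  proof -
    have "(f ^^ Suc k) ((f ^^ i) (f x)) = (f ^^ (Suc k + Suc i)) x"
      by (simp only: funpow_add funpow_Suc_right[of i] o_apply)
    \<comment> \<open>The exponent is regrouped so that \<open>f ^^ Suc (Suc k)\<close>, which kills
      \<open>x\<close>, acts first.\<close>
    also have "Suc k + Suc i = i + Suc (Suc k)"
      by simp
    also have "(f ^^ (i + Suc (Suc k))) x = (f ^^ i) ((f ^^ Suc (Suc k)) x)"
      by (simp only: funpow_add o_apply)
    finally show ?thesis using Suc.prems(2) zero by simp
  qed
  then have "?S \<subseteq> {v. (f ^^ Suc k) v = 0}"
    by blast
  then have "span ?S \<subseteq> {v. (f ^^ Suc k) v = 0}"
    by (rule span_minimal) (rule F.subspace_kernel)
  then have x: "x \<notin> span ?S"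
    using Suc.prems(1) by (auto simp del: funpow.simps)
  have insert: "(\<lambda>i. (f ^^ i) x) ` {..Suc k} = insert x ?S"
    by (simp only: atMost_Suc_eq_insert_0 image_insert image_image funpow_Suc_right o_apply
      funpow_0)
  have "x \<notin> ?S"
    using x span_superset[of ?S] by (rule contra_subsetD[rotated])
  then have "card (insert x ?S) = Suc (Suc k)"
    by (simp only: card_insert_disjoint[OF finite_imageI[OF finite_atMost]] S(2)
      not_False_eq_True)
  then show ?case
    unfolding insert using independent_insertI[OF x S(1)] by (rule conjI[rotated])
qed

text \<open>Otherwise the chain of \<open>x\<close> would give \<open>k + 1\<close> independent
  vectors in a space spanned by at most \<open>k\<close>.\<close>

lemma funpow_kernel_stable:
  assumes f: "Vector_Spaces.linear scale scale f"
    and B: "finite B" "span B = UNIV"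
    and "card B \<le> k" "(f ^^ Suc k) x = 0"
  shows "(f ^^ k) x = 0"
proof (rule ccontr)
  assume "(f ^^ k) x \<noteq> 0"
  from funpow_kernel_chain_independent[OF f this assms(5)]
  have "independent ((\<lambda>i. (f ^^ i) x) ` {..k})" "card ((\<lambda>i. (f ^^ i) x) ` {..k}) = Suc k"
    by blast+
  then show False
    using independent_span_bound[OF B(1), of "(\<lambda>i. (f ^^ i) x) ` {..k}"] assms(4) B(2) by simp
qed

end

context lie_algebra
begin

lemma linear_bracket_left: "Vector_Spaces.linear scale scale (\<lambda>x. bracket x y)"
  by unfold_locales (simp_all add: bracket_add_left bracket_scale_left)

text \<open>Reduces Engel values to iterates of one endomorphism. Taking the bracket with
  \<open>f Y\<close> on the right, that is, the negative of its adjoint map, avoids signs.\<close>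

lemma subst_engel_E: "subst_lie f (engel_E n) = ((\<lambda>x. bracket x (f Y)) ^^ n) (f X)"
  by (induction n) (simp_all add: subst_lie_simps)

lemma central_engel_value_eq_zero:
  assumes B: "finite B" "span B = UNIV" and m: "card B < m"
    and z: "polynomial_map (engel_polynomial m) (x, y) \<in> centre"
  shows "polynomial_map (engel_polynomial m) (x, y) = 0"
proof -
  let ?f = "\<lambda>x. bracket x y"
  have eq: "polynomial_map (engel_polynomial m) (x, y) = (?f ^^ (m - 1)) x"
    by (simp add: polynomial_map_def engel_polynomial_def subst_engel_E)
  \<comment> \<open>Centrality is tested against \<open>y\<close>, which amounts to one more
    application of \<open>?f\<close>.\<close>
  have "(?f ^^ Suc (m - 1)) x = 0"
    using z unfolding eq by (simp add: centre_def)
  then show ?thesis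
    unfolding eq by (rule funpow_kernel_stable[OF linear_bracket_left B, rotated]) (use m in simp)
qed

end

theorem proposition4p6:
  fixes sC :: "complex \<Rightarrow> 'g::ab_group_add \<Rightarrow> 'g" and brC :: "'g \<Rightarrow> 'g \<Rightarrow> 'g"
    and sK :: "'k::field \<Rightarrow> 'l::ab_group_add \<Rightarrow> 'l" and brK :: "'l \<Rightarrow> 'l \<Rightarrow> 'l"
    and R \<Delta> :: "'v::real_inner set"
    and H :: "'g set" and \<iota> :: "'v \<Rightarrow> 'g \<Rightarrow> complex" and e :: "'v \<Rightarrow> 'g"
    and b :: "'v + 'v \<Rightarrow> 'l"
  assumes "chevalley_algebra sC brC sK brK R \<Delta> H \<iota> e b"
  shows "\<exists>M\<ge>2. \<forall>m\<ge>M. \<forall>z \<in> lie_algebra.centre brK.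
    z \<noteq> 0 \<longrightarrow> z \<notin> range (lie_algebra.polynomial_map sK brK (engel_polynomial m))"
proof -
  interpret chevalley_algebra sC brC sK brK R \<Delta> H \<iota> e b
    by (rule assms)
  let ?B = "b ` (\<Delta> <+> R)"
  have "finite R" "\<Delta> \<subseteq> R"
    using root_system simple by (auto simp: reduced_root_system_def simple_roots_def)
  then have fin: "finite ?B"
    using finite_subset[of \<Delta> R] by simp
  have span: "L.span ?B = UNIV"
    using basis by (simp add: L.is_basis_def)
  have "z \<notin> range (L.polynomial_map (engel_polynomial m))"
    if "card ?B + 2 \<le> m" "z \<in> L.centre" "z \<noteq> 0" for m z
  proof
    assume "z \<in> range (L.polynomial_map (engel_polynomial m))"
    then obtain x y where "z = L.polynomial_map (engel_polynomial m) (x, y)"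
      by auto
    with L.central_engel_value_eq_zero[OF fin span, of m x y] that show False
      by simp
  qed
  \<comment> \<open>One more than \<open>card ?B\<close> would satisfy the strict bound; the second
    unit keeps the threshold at least 2 even for the empty root system.\<close>
  then show ?thesis
    by (intro exI[of _ "card ?B + 2"]) simp
qed

end
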